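(* Let $r,l\in\mathbb{N}$, $\mathbf{m}=(m_1,\dots,m_r)\in\mathbb{N}^r$, $m=m_1+\cdots+m_r$, $\mathbf{f}=(f_1,\dots,f_r)\in\mathbb{C}^r$, $\mathbf{p}=(p_1,\dots,p_l)\in\mathbb{N}^l$, $p=p_1+\cdots+p_l$, $\mathbf{h}\in\mathbb{C}^l$ and $b,c,d,e\in\mathbb{C}$. Suppose $b\ne f_j$ for $j=1,\dots,r$ and $(c-b-m)_m\ne0$. Then for each $n\in\mathbb{N}$ $$ F\left(\begin{matrix}-n,b,d,\mathbf{f}+\mathbf{m},\mathbf{h}+\mathbf{p}\\c,e,\mathbf{f},\mathbf{h}\end{matrix}\right) =\frac{(e-d)_n\,\Gamma(e-d)}{(e)_n\,(1+d-e-n)_p\,(\mathbf{h})_{\mathbf{p}}}\,F\left(\begin{matrix}-n,\;c-b-m,\;d,\;\boldsymbol\zeta+1\\c,\;1+d-e-n+p,\;\boldsymbol\zeta\end{matrix}\;\vdots\;Y_p(1,1)\right), $$ where $Y_p(1,1)$ denotes the polynomial $t\mapsto Y_p(1,1;t)$ with $\lambda=n$, and $\boldsymbol\zeta=(\zeta_1,\dots,\zeta_m)$ is the vector of zeros of the polynomial $Q_m(b,c,\mathbf{f},\mathbf{m};t)$. (Both polynomials are defined in the context.) The formula remains valid for $m=0$ if the parameters $\mathbf{f}+\mathbf{m}$, $\mathbf{f}$, $\boldsymbol\zeta+1$, $\boldsymbol\zeta$ are omitted.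
   Context: Notation: $(a)_n=\Gamma(a+n)/\Gamma(a)$; for vectors, $(\mathbf{a})_n=\prod_j(a_j)_n$, $(\mathbf{h})_{\mathbf{p}}=\prod_i(h_i)_{p_i}$, and $\mathbf{a}+\beta$ means adding $\beta$ to each component. For parameter vectors $\mathbf{a},\mathbf{b}$ and a polynomial $P$, $$F\left(\begin{matrix}\mathbf{a}\\\mathbf{b}\end{matrix}\;\vdots\;P\right)=\sum_{k\ge0}\frac{(\mathbf{a})_k}{(\mathbf{b})_k\,k!}P(k)$$ with $P\equiv1$ when $P$ is omitted (generalized hypergeometric series at unit argument). Standing convention: lower parameters of hypergeometric functions are never non-positive integers, and all expressions occurring (Gamma functions, denominators) are defined. Polynomial $Y_p$: for $\lambda\in\mathbb{C}$, $$ Y_p(u,v;t)=\frac{(\mathbf{h}-d)_{\mathbf{p}}}{\Gamma(e-d)}\sum_{j=0}^{p}\frac{(d-e+1)_{j}}{j!}\,F\left(\begin{matrix}-j,1-\mathbf{h}+d\\1-\mathbf{h}+d-\mathbf{p}\end{matrix}\right)(ut+d)_{j}\,(vt+d-e-\lambda+j+1)_{p-j}. $$ Polynomial $Q_m$: $$ Q_m(b,c,\mathbf{f},\mathbf{m};t)=\frac{1}{(c-b-m)_{m}}\sum_{k=0}^{m}\frac{(-1)^k}{k!}\;{}_{r+1}F_{r}\left(\begin{matrix}-k,\mathbf{f}+\mathbf{m}\\\mathbf{f}\end{matrix}\,\Big|\,1\right)(b)_k(t)_{k}(c-b-m-t)_{m-k}. $$ Zeros are listed with multiplicity; as implicit in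 the notation $(\zeta_1,\dots,\zeta_m)$, $Q_m$ is taken to have exact degree $m$. *)

theory Defs
  imports "HOL-Analysis.Analysis" "HOL-Computational_Algebra.Computational_Algebra"
begin

text \<open>
  Parameter vectors are lists. The symbol \<open>(a)\<^sub>n\<close> is the library's \<^const>\<open>pochhammer\<close>, that is, the
  product form of \<open>\<Gamma>(a + n) / \<Gamma>(a)\<close>, which also makes sense when \<open>a\<close> is a non-positive integer.
\<close>

definition pochhammer_list :: "'a::comm_semiring_1 list \<Rightarrow> nat \<Rightarrow> 'a" where
  "pochhammer_list as n = (\<Prod>a\<leftarrow>as. pochhammer a n)"

text \<open>\<open>(h)\<^sub>p\<close> for vectors \<open>h\<close>, \<open>p\<close> of equal length:\<close>

definition pochhammer_lists :: "'a::comm_semiring_1 list \<Rightarrow> nat list \<Rightarrow> 'a" where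
  "pochhammer_lists hs ps = prod_list (map2 pochhammer hs ps)"

definition shift_list :: "complex list \<Rightarrow> nat list \<Rightarrow> complex list" where
  "shift_list fs ms = map2 (\<lambda>f m. f + of_nat m) fs ms"

definition hypergeo_poly :: "complex list \<Rightarrow> complex list \<Rightarrow> complex poly \<Rightarrow> complex" where
  "hypergeo_poly as bs P =
     (\<Sum>k. pochhammer_list as k / (pochhammer_list bs k * fact k) * poly P (of_nat k))"

abbreviation hypergeo :: "complex list \<Rightarrow> complex list \<Rightarrow> complex" where
  "hypergeo as bs \<equiv> hypergeo_poly as bs 1"

lemma hypergeo_eq_eval_fps: "hypergeo as bs = eval_fps (fps_hypergeo as bs 1) 1"
proof -
  have *: "foldl (\<lambda>r a. r * pochhammer a n) x cs = x * pochhammer_list cs n"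
    for x :: complex and cs n
    by (induction cs arbitrary: x) (simp_all add: pochhammer_list_def mult_ac)
  show ?thesis
    by (simp add: hypergeo_poly_def eval_fps_def *)
qed

text \<open>If \<open>-n\<close> is an upper parameter then the series terminates.\<close>

lemma hypergeo_poly_terminating:
  "hypergeo_poly (- of_nat n # as) bs P =
     (\<Sum>k\<le>n. pochhammer_list (- of_nat n # as) k / (pochhammer_list bs k * fact k)
               * poly P (of_nat k))"
  unfolding hypergeo_poly_def
  by (rule suminf_finite)
     (auto simp: pochhammer_list_def pochhammer_of_nat_eq_0_iff)

text \<open>
  The polynomials \<open>Y\<^sub>p(u, v; t)\<close> and \<open>Q\<^sub>m(b, c, f, m; t)\<close> in the indeterminate \<open>t\<close>. A linear
  polynomial \<open>u t + d\<close> is written \<^term>\<open>[:d, u:]\<close>, and its rising factorials are taken in the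
  polynomial ring.
\<close>

definition Y_poly ::
  "complex \<Rightarrow> complex \<Rightarrow> complex list \<Rightarrow> nat list \<Rightarrow> complex \<Rightarrow> complex \<Rightarrow> complex \<Rightarrow> complex poly" where
  "Y_poly d e hs ps lam u v =
     (let p = sum_list ps in
      smult (pochhammer_lists (map (\<lambda>h. h - d) hs) ps / Gamma (e - d))
        (\<Sum>j\<le>p.
           smult (pochhammer (d - e + 1) j / fact j
                  * hypergeo (- of_nat j # map (\<lambda>h. 1 - h + d) hs)
                             (map2 (\<lambda>h q. 1 - h + d - of_nat q) hs ps))
             (pochhammer [:d, u:] j
              * pochhammer [:d - e - lam + of_nat j + 1, v:] (p - j))))"

definition Q_poly ::
  "complex \<Rightarrow> complex \<Rightarrow> complex list \<Rightarrow> nat list \<Rightarrow> complex poly" where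
  "Q_poly b c fs ms =
     (let m = sum_list ms in
      smult (1 / pochhammer (c - b - of_nat m) m)
        (\<Sum>k\<le>m.
           smult ((-1) ^ k / fact k
                  * hypergeo (- of_nat k # shift_list fs ms) fs
                  * pochhammer b k)
             (pochhammer [:0, 1:] k
              * pochhammer [:c - b - of_nat m, - 1:] (m - k))))"

end

theory Submission
  imports Defs
begin

text \<open>
  Put \<open>\<alpha>\<^sub>j = (b)\<^sub>j (f + m)\<^sub>j / ((c)\<^sub>j (f)\<^sub>j)\<close>. Since \<open>(f + m)\<^sub>j / (f)\<^sub>j\<close> is a polynomial in \<open>j\<close> of degree \<open>m\<close>,
  Newton interpolation at \<open>0, \<dots>, m\<close> and the Chu--Vandermonde sum show that the binomial transform of
  \<open>\<alpha>\<close> is \<open>\<beta>\<^sub>k = (c - b - m)\<^sub>k Q\<^sub>m(-k) / (c)\<^sub>k\<close>, and \<open>Q\<^sub>m(-k) = (\<zeta> + 1)\<^sub>k / (\<zeta>)\<^sub>k\<close> because \<open>Q\<^sub>m(0) = 1\<close>. As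
  the binomial transform is an involution, the left-hand side can be expanded in the \<open>\<beta>\<^sub>k\<close>. The
  coefficient of \<open>\<beta>\<^sub>k\<close> is again summed by Chu--Vandermonde, once the polynomial \<open>(h + t)\<^sub>p\<close> is written
  in the basis \<open>(d + t)\<^sub>i\<close>; the hypergeometric factors in \<open>Y\<^sub>p\<close> are the coordinates in that basis.
\<close>

section \<open>Binomial transform and Chu-Vandermonde summation\<close>

text \<open>Since \<open>(-n)_j / j! = (-1)^j (n choose j)\<close>, this is the alternating binomial
  sum of \<open>a\<close>. The Pochhammer form matches the terms of a series that terminates through
  an upper parameter \<open>-n\<close>.\<close>

definition binomial_transform :: "(nat \<Rightarrow> complex) \<Rightarrow> nat \<Rightarrow> complex" where
  "binomial_transform a n = (\<Sum>j\<le>n. pochhammer (- of_nat n) j / fact j * a j)"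

lemma pochhammer_neq_0: "z \<notin> \<int>\<^sub>\<le>\<^sub>0 \<Longrightarrow> pochhammer z n \<noteq> (0::complex)"
  by (auto simp: pochhammer_eq_0_iff)

text \<open>Reads the product backwards: the last factor of \<open>(z)_n\<close> is
  \<open>-w\<close>, the one before it \<open>-(w + 1)\<close>, and so on. The hypothesis links
  \<open>z\<close> and \<open>w\<close> symmetrically, so either base may be given in whatever form
  occurs.\<close>

lemma pochhammer_diff_swap:
  fixes z w :: "'a::comm_ring_1"
  assumes "z + w = 1 - of_nat n"
  shows "pochhammer z n = (-1) ^ n * pochhammer w n"
proof -
  have "z = - (w + of_nat n - 1)"
    using assms by (simp add: algebra_simps eq_neg_iff_add_eq_0)
  then show ?thesis
    using pochhammer_minus[of "w + of_nat n - 1" n] by simp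
qed

text \<open>Both sides are \<open>(z)_(m+n)\<close>. This is what turns
  \<open>(f + m)_k / (f)_k\<close> into the polynomial quotient
  \<open>(f + k)_m / (f)_m\<close>.\<close>

lemma pochhammer_add_commute:
  fixes z :: "'a::comm_semiring_1"
  shows "pochhammer z m * pochhammer (z + of_nat m) n = pochhammer z n * pochhammer (z + of_nat n) m"
  by (simp add: add.commute flip: pochhammer_product')

lemma pochhammer_uminus_of_nat_add:
  "pochhammer (- of_nat (i + s)) i = (-1) ^ i * fact (i + s) / (fact s :: complex)"
proof -
  have "fact (i + s) = fact s * pochhammer (1 + of_nat s :: complex) i"
    using pochhammer_product'[of "1::complex" s i] by (simp add: pochhammer_fact add.commute)
  moreover have "pochhammer (- of_nat (i + s)) i = (-1) ^ i * pochhammer (1 + of_nat s :: complex) i"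
    by (rule pochhammer_diff_swap) simp
  ultimately show ?thesis by simp
qed

text \<open>The identity \<open>(n choose j) (j choose i) = (n choose i) (n-i choose j-i)\<close>,
  summed after the substitution \<open>j = i + s\<close>; terms with \<open>j < i\<close> vanish
  through \<open>(-j)_i\<close>. If \<open>i > n\<close>, then \<open>n - i\<close> truncates to 0,
  but both sides are 0 because \<open>(-n)_i = 0\<close>.\<close>

lemma sum_binomial_shift:
  fixes g :: "nat \<Rightarrow> complex"
  shows "(\<Sum>j\<le>n. pochhammer (- of_nat n) j / fact j * (pochhammer (- of_nat j) i / fact i) * g j)
     = (-1) ^ i * pochhammer (- of_nat n) i / fact i
         * (\<Sum>s\<le>n - i. pochhammer (- of_nat (n - i)) s / fact s * g (i + s))"
    (is "?l = ?r")
proof (cases "i \<le> n")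
  case True
  have "?l = (\<Sum>j\<in>{i..n}. pochhammer (- of_nat n) j / fact j
                * (pochhammer (- of_nat j) i / fact i) * g j)"
    by (rule sum.mono_neutral_right) (auto simp: pochhammer_of_nat_eq_0_iff)
  also have "\<dots> = (\<Sum>s\<le>n - i. pochhammer (- of_nat n) (i + s) / fact (i + s)
                * (pochhammer (- of_nat (i + s)) i / fact i) * g (i + s))"
    by (rule sum.reindex_bij_witness[of _ "\<lambda>s. i + s" "\<lambda>j. j - i"]) (use True in auto)
  also have "\<dots> = ?r"
    unfolding sum_distrib_left
  proof (rule sum.cong[OF refl])
    fix s
    have "pochhammer (- of_nat n) (i + s)
        = pochhammer (- of_nat n) i * pochhammer (- of_nat (n - i) :: complex) s"
      using True by (simp add: pochhammer_product' of_nat_diff)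
    then show "pochhammer (- of_nat n) (i + s) / fact (i + s)
        * (pochhammer (- of_nat (i + s)) i / fact i) * g (i + s)
      = (-1) ^ i * pochhammer (- of_nat n) i / fact i
        * (pochhammer (- of_nat (n - i)) s / fact s * g (i + s))"
      unfolding pochhammer_uminus_of_nat_add by (simp add: mult_ac)
  qed
  finally show ?thesis .
next
  case False
  have "?l = 0"
    by (rule sum.neutral) (use False in \<open>auto simp: pochhammer_of_nat_eq_0_iff\<close>)
  moreover have "pochhammer (- of_nat n :: complex) i = 0"
    using False by (simp add: pochhammer_of_nat_eq_0_iff)
  ultimately show ?thesis by simp
qed

text \<open>Pulling out \<open>(a)_(k+i) / (c)_k\<close> leaves a Chu-Vandermonde sum with
  parameters \<open>a + k + i\<close> and \<open>c + k\<close>. The offset \<open>k\<close> comes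
  from shifted summation ranges, the offset \<open>i\<close> from basis polynomials
  \<open>(a + t)_i\<close>.\<close>

lemma Vandermonde_pochhammer_shifted:
  fixes a c :: complex
  assumes "c \<notin> \<int>\<^sub>\<le>\<^sub>0"
  shows "(\<Sum>s\<le>n. pochhammer (- of_nat n) s / fact s
            * (pochhammer a (k + s + i) / pochhammer c (k + s)))
         = pochhammer a (k + i) * pochhammer (c - a - of_nat i) n / pochhammer c (k + n)"
proof -
  have c: "c + of_nat k \<notin> \<int>\<^sub>\<le>\<^sub>0"
    using assms by (metis add_diff_cancel_right' nonpos_Ints_diff_Nats of_nat_in_Nats)
  have "(\<Sum>s\<le>n. pochhammer (- of_nat n) s / fact s
            * (pochhammer a (k + s + i) / pochhammer c (k + s)))
      = pochhammer a (k + i) / pochhammer c k *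
        (\<Sum>s\<in>{0..n}. pochhammer (a + of_nat (k + i)) s * pochhammer (- of_nat n) s
            / (of_nat (fact s) * pochhammer (c + of_nat k) s))"
    unfolding sum_distrib_left atMost_atLeast0
  proof (rule sum.cong[OF refl])
    fix s
    have "pochhammer a (k + s + i) = pochhammer a (k + i) * pochhammer (a + of_nat (k + i)) s"
      by (metis add.assoc add.commute pochhammer_product')
    then show "pochhammer (- of_nat n) s / fact s * (pochhammer a (k + s + i) / pochhammer c (k + s))
      = pochhammer a (k + i) / pochhammer c k * (pochhammer (a + of_nat (k + i)) s
          * pochhammer (- of_nat n) s / (of_nat (fact s) * pochhammer (c + of_nat k) s))"
      by (simp add: pochhammer_product'[of c] mult_ac)
  qed
  also have "(\<Sum>s\<in>{0..n}. pochhammer (a + of_nat (k + i)) s * pochhammer (- of_nat n) s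
            / (of_nat (fact s) * pochhammer (c + of_nat k) s))
      = pochhammer (c + of_nat k - (a + of_nat (k + i))) n / pochhammer (c + of_nat k) n"
    by (rule Vandermonde_pochhammer) (use c in auto)
  also have "c + of_nat k - (a + of_nat (k + i)) = c - a - of_nat i"
    by simp
  finally show ?thesis
    by (simp add: pochhammer_product')
qed

lemma binomial_transform_involution:
  "binomial_transform (binomial_transform a) n = a n"
proof -
  \<comment> \<open>Extending the range to \<open>n\<close> adds only zero terms and makes the
    double sum rectangular, so that the order of summation can be exchanged.\<close>
  have pad: "binomial_transform a i = (\<Sum>s\<le>n. pochhammer (- of_nat i) s / fact s * a s)"
    if "i \<le> n" for i
    unfolding binomial_transform_def
    by (rule sum.mono_neutral_left) (use that in \<open>auto simp: pochhammer_of_nat_eq_0_iff\<close>)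
  have kernel: "(\<Sum>i\<le>n. pochhammer (- of_nat n) i / fact i
                  * (pochhammer (- of_nat i) s / fact s)) = (if s = n then 1 else 0 :: complex)"
    if "s \<le> n" for s
  proof -
    have "(\<Sum>i\<le>n. pochhammer (- of_nat n) i / fact i * (pochhammer (- of_nat i) s / fact s))
        = (-1) ^ s * pochhammer (- of_nat n) s / fact s
            * (\<Sum>t\<le>n - s. pochhammer (- of_nat (n - s)) t / (fact t :: complex))"
      using sum_binomial_shift[of n s "\<lambda>_. 1"] by simp
    also have "(\<Sum>t\<le>n - s. pochhammer (- of_nat (n - s)) t / (fact t :: complex))
        = (if s = n then 1 else 0)"
      \<comment> \<open>With both parameters equal to 1 the sum is a multiple of
        \<open>(0)_(n-s)\<close>, which vanishes unless \<open>s = n\<close>.\<close>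
      using Vandermonde_pochhammer_shifted[of 1 "n - s" 1 0 0] that
      by (auto simp: pochhammer_neq_0 pochhammer_0_left)
    finally show ?thesis
      by (auto simp: pochhammer_same power_mult_distrib[symmetric])
  qed
  have "binomial_transform (binomial_transform a) n
      = (\<Sum>i\<le>n. \<Sum>s\<le>n. pochhammer (- of_nat n) i / fact i
          * (pochhammer (- of_nat i) s / fact s) * a s)"
    by (subst binomial_transform_def) (simp add: pad sum_distrib_left mult_ac)
  also have "\<dots> = (\<Sum>s\<le>n. (\<Sum>i\<le>n. pochhammer (- of_nat n) i / fact i
          * (pochhammer (- of_nat i) s / fact s)) * a s)"
    by (subst sum.swap) (simp add: sum_distrib_right)
  also have "\<dots> = (\<Sum>s\<le>n. (if s = n then 1 else 0) * a s)"
    by (intro sum.cong refl) (simp only: kernel atMost_iff)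
  also have "\<dots> = a n"
    by (simp add: if_distrib[of "\<lambda>x. x * _"] cong: if_cong)
  finally show ?thesis .
qed

section \<open>Newton interpolation\<close>

lemma poly_pochhammer: "poly (pochhammer P n) x = pochhammer (poly P x) n"
  by (induction n) (simp_all add: pochhammer_Suc)

lemma degree_pochhammer_le: "degree (pochhammer P n) \<le> degree P * n"
  for P :: "'a::comm_semiring_1 poly"
proof (induction n)
  case (Suc n)
  have "degree (pochhammer P (Suc n)) \<le> degree (pochhammer P n) + degree (P + of_nat n)"
    unfolding pochhammer_Suc by (rule degree_mult_le)
  also have "degree (P + of_nat n) \<le> degree P"
    by (rule degree_add_le) auto
  finally show ?case using Suc by simp
qed simp

text \<open>Newton's forward difference formula at the nodes \<open>0, ..., m\<close>, with basis
  \<open>(-x)_i / i! = (-1)^i (x choose i)\<close>. Both sides have degree at most \<open>m\<close>,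
  so agreement at the \<open>m + 1\<close> nodes suffices.\<close>

lemma newton_expansion:
  assumes "degree P \<le> m"
  shows "poly P x = (\<Sum>i\<le>m. binomial_transform (\<lambda>s. poly P (of_nat s)) i
                       * (pochhammer (- x) i / fact i))"
proof -
  define R where "R = (\<Sum>i\<le>m. smult (binomial_transform (\<lambda>s. poly P (of_nat s)) i / fact i)
                       (pochhammer [:0, -1:] i))"
  have R: "poly R x = (\<Sum>i\<le>m. binomial_transform (\<lambda>s. poly P (of_nat s)) i
                       * (pochhammer (- x) i / fact i))" for x
    by (simp add: R_def poly_sum poly_pochhammer)
  have "P = R"
  proof (rule poly_eqI_degree)
    show "card (of_nat ` {..m} :: complex set) > degree P"
      using assms by (simp add: card_image)
    have "degree R \<le> m"
      unfolding R_def
    proof (rule degree_sum_le)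
      fix i assume "i \<in> {..m}"
      then show "degree (smult (binomial_transform (\<lambda>s. poly P (of_nat s)) i / fact i)
                   (pochhammer [:0, -1:] i)) \<le> m"
        using degree_pochhammer_le[of "[:0, -1 :: complex:]" i]
        by (simp add: order.trans[OF degree_smult_le])
    qed simp
    then show "card (of_nat ` {..m} :: complex set) > degree R"
      by (simp add: card_image)
    fix x :: complex assume "x \<in> of_nat ` {..m}"
    then obtain k where k: "x = of_nat k" "k \<le> m" by auto
    \<comment> \<open>At a node \<open>k\<close> the basis polynomials with \<open>i > k\<close>
      vanish, so the value is the double transform, to which the involution applies.\<close>
    have "poly R x = binomial_transform (binomial_transform (\<lambda>s. poly P (of_nat s))) k"
      unfolding R k(1) binomial_transform_def[of "binomial_transform _"]
      by (rule sum.mono_neutral_cong_right)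
         (use k in \<open>auto simp: pochhammer_of_nat_eq_0_iff\<close>)
    then show "poly P x = poly R x"
      by (simp add: binomial_transform_involution k)
  qed
  then have "poly P x = poly R x"
    by (rule arg_cong)
  also note R
  finally show ?thesis .
qed

section \<open>Transforms of sequences with polynomial factors\<close>

text \<open>Write \<open>a\<close> as the transform of its transform and exchange the sums; the sum
  over \<open>j\<close> then becomes a Chu-Vandermonde sum for each basis element
  \<open>(d + t)_i\<close> of \<open>H\<close>.\<close>

lemma sum_binomial_transform_kernel:
  assumes e: "e \<notin> \<int>\<^sub>\<le>\<^sub>0"
    and H: "\<And>t. poly H t = (\<Sum>i\<le>p. E i * (pochhammer (d + t) i / fact i))"
  shows "(\<Sum>j\<le>n. pochhammer (- of_nat n) j / fact j * (pochhammer d j / pochhammer e j)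
             * poly H (of_nat j) * a j)
    = (\<Sum>k\<le>n. (-1) ^ k * pochhammer (- of_nat n) k / fact k * binomial_transform a k
         * (\<Sum>i\<le>p. E i / fact i * (pochhammer d (k + i) * pochhammer (e - d - of_nat i) (n - k)
                       / pochhammer e n)))"
proof -
  have a: "a j = (\<Sum>k\<le>n. pochhammer (- of_nat j) k / fact k * binomial_transform a k)"
    if "j \<le> n" for j
  proof -
    have "a j = (\<Sum>k\<le>j. pochhammer (- of_nat j) k / fact k * binomial_transform a k)"
      by (metis binomial_transform_def binomial_transform_involution)
    also have "\<dots> = (\<Sum>k\<le>n. pochhammer (- of_nat j) k / fact k * binomial_transform a k)"
      by (rule sum.mono_neutral_left) (use that in \<open>auto simp: pochhammer_of_nat_eq_0_iff\<close>)
    finally show ?thesis .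
  qed
  \<comment> \<open>The basis \<open>(d + t)_i\<close> is chosen because
    \<open>(d)_(k+s) (d+k+s)_i = (d)_(k+s+i)\<close>, which keeps every term in the form needed for
    Chu-Vandermonde.\<close>
  have inner: "(\<Sum>s\<le>n - k. pochhammer (- of_nat (n - k)) s / fact s
        * (pochhammer d (k + s) / pochhammer e (k + s) * poly H (of_nat (k + s))))
      = (\<Sum>i\<le>p. E i / fact i * (pochhammer d (k + i) * pochhammer (e - d - of_nat i) (n - k)
                       / pochhammer e n))" if "k \<le> n" for k
  proof -
    have "(\<Sum>s\<le>n - k. pochhammer (- of_nat (n - k)) s / fact s
        * (pochhammer d (k + s) / pochhammer e (k + s) * poly H (of_nat (k + s))))
      = (\<Sum>s\<le>n - k. \<Sum>i\<le>p. E i / fact i * (pochhammer (- of_nat (n - k)) s / fact s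
        * (pochhammer d (k + s + i) / pochhammer e (k + s))))"
      unfolding H sum_distrib_left
      by (intro sum.cong refl) (simp add: pochhammer_product'[of d "k + _"] mult_ac)
    also have "\<dots> = (\<Sum>i\<le>p. E i / fact i * (\<Sum>s\<le>n - k. pochhammer (- of_nat (n - k)) s / fact s
        * (pochhammer d (k + s + i) / pochhammer e (k + s))))"
      by (subst sum.swap) (simp only: sum_distrib_left)
    also have "\<dots> = (\<Sum>i\<le>p. E i / fact i * (pochhammer d (k + i)
        * pochhammer (e - d - of_nat i) (n - k) / pochhammer e n))"
      using that by (simp only: Vandermonde_pochhammer_shifted[OF e] le_add_diff_inverse)
    finally show ?thesis .
  qed
  have "(\<Sum>j\<le>n. pochhammer (- of_nat n) j / fact j * (pochhammer d j / pochhammer e j)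
             * poly H (of_nat j) * a j)
    = (\<Sum>j\<le>n. \<Sum>k\<le>n. binomial_transform a k * (pochhammer (- of_nat n) j / fact j
        * (pochhammer (- of_nat j) k / fact k)
        * (pochhammer d j / pochhammer e j * poly H (of_nat j))))"
    by (intro sum.cong refl, subst a) (auto simp: sum_distrib_left sum_divide_distrib mult_ac)
  also have "\<dots> = (\<Sum>k\<le>n. binomial_transform a k * (\<Sum>j\<le>n. pochhammer (- of_nat n) j / fact j
        * (pochhammer (- of_nat j) k / fact k)
        * (pochhammer d j / pochhammer e j * poly H (of_nat j))))"
    by (subst sum.swap) (simp only: sum_distrib_left)
  also have "\<dots> = (\<Sum>k\<le>n. (-1) ^ k * pochhammer (- of_nat n) k / fact k * binomial_transform a k
         * (\<Sum>i\<le>p. E i / fact i * (pochhammer d (k + i) * pochhammer (e - d - of_nat i) (n - k)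
                       / pochhammer e n)))"
    unfolding sum_binomial_shift by (intro sum.cong refl) (simp only: inner atMost_iff, simp only: mult_ac)
  finally show ?thesis .
qed

text \<open>Here the Newton basis \<open>(-j)_i\<close> is the convenient one:
  \<open>sum_binomial_shift\<close> absorbs it and leaves a plain Chu-Vandermonde sum. For
  \<open>i > k\<close> the truncated \<open>k - i\<close> is harmless, since
  \<open>(-k)_i = 0\<close>.\<close>

lemma binomial_transform_pochhammer_quotient:
  assumes c: "c \<notin> \<int>\<^sub>\<le>\<^sub>0" and P: "degree P \<le> m"
  shows "binomial_transform (\<lambda>j. pochhammer b j / pochhammer c j * poly P (of_nat j)) k
    = (\<Sum>i\<le>m. binomial_transform (\<lambda>s. poly P (of_nat s)) i
        * ((-1) ^ i * pochhammer (- of_nat k) i / fact i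
           * (pochhammer b i * pochhammer (c - b) (k - i) / pochhammer c k)))"
    (is "_ = (\<Sum>i\<le>m. ?q i * _)")
proof -
  have "binomial_transform (\<lambda>j. pochhammer b j / pochhammer c j * poly P (of_nat j)) k
    = (\<Sum>j\<le>k. pochhammer (- of_nat k) j / fact j
        * (pochhammer b j / pochhammer c j * poly P (of_nat j)))"
    by (rule binomial_transform_def)
  also have "\<dots> = (\<Sum>j\<le>k. \<Sum>i\<le>m. ?q i * (pochhammer (- of_nat k) j / fact j
        * (pochhammer (- of_nat j) i / fact i) * (pochhammer b j / pochhammer c j)))"
    by (intro sum.cong refl, subst newton_expansion[OF P]) (simp add: sum_distrib_left mult_ac)
  also have "\<dots> = (\<Sum>i\<le>m. ?q i * (\<Sum>j\<le>k. pochhammer (- of_nat k) j / fact j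
        * (pochhammer (- of_nat j) i / fact i) * (pochhammer b j / pochhammer c j)))"
    by (subst sum.swap) (simp only: sum_distrib_left)
  also have "\<dots> = (\<Sum>i\<le>m. ?q i * ((-1) ^ i * pochhammer (- of_nat k) i / fact i
           * (pochhammer b i * pochhammer (c - b) (k - i) / pochhammer c k)))"
  proof (intro sum.cong refl)
    fix i
    have "(-1) ^ i * pochhammer (- of_nat k) i / fact i
          * (\<Sum>s\<le>k - i. pochhammer (- of_nat (k - i)) s / fact s
               * (pochhammer b (i + s) / pochhammer c (i + s)))
        = (-1) ^ i * pochhammer (- of_nat k) i / fact i
          * (pochhammer b i * pochhammer (c - b) (k - i) / pochhammer c k)"
    proof (cases "i \<le> k")
      case True
      then show ?thesis
        using Vandermonde_pochhammer_shifted[OF c, of "k - i" b i 0] by simp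
    next
      case False
      then have "pochhammer (- of_nat k :: complex) i = 0"
        by (simp add: pochhammer_of_nat_eq_0_iff)
      then show ?thesis by simp
    qed
    then show "?q i * (\<Sum>j\<le>k. pochhammer (- of_nat k) j / fact j
        * (pochhammer (- of_nat j) i / fact i) * (pochhammer b j / pochhammer c j))
      = ?q i * ((-1) ^ i * pochhammer (- of_nat k) i / fact i
           * (pochhammer b i * pochhammer (c - b) (k - i) / pochhammer c k))"
      unfolding sum_binomial_shift by simp
  qed
  finally show ?thesis .
qed

section \<open>Parameter pairs with integral differences\<close>

text \<open>The polynomial \<open>(f + t)_m\<close> in \<open>t\<close>; divided by its value
  \<open>(f)_m\<close> at 0 it interpolates \<open>(f + m)_k / (f)_k\<close> at
  \<open>t = k\<close>.\<close>

definition shifted_pochhammer_poly :: "complex list \<Rightarrow> nat list \<Rightarrow> complex poly" where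
  "shifted_pochhammer_poly fs ms = pochhammer_lists (map (\<lambda>f. [:f, 1:]) fs) ms"

lemma shifted_pochhammer_poly_Nil [simp]: "shifted_pochhammer_poly [] [] = 1"
  and shifted_pochhammer_poly_Cons [simp]:
    "shifted_pochhammer_poly (f # fs) (m # ms) = pochhammer [:f, 1:] m * shifted_pochhammer_poly fs ms"
  by (simp_all add: shifted_pochhammer_poly_def pochhammer_lists_def)

lemma pochhammer_lists_Nil [simp]: "pochhammer_lists [] [] = 1"
  and pochhammer_lists_Cons [simp]:
    "pochhammer_lists (f # fs) (m # ms) = pochhammer f m * pochhammer_lists fs ms"
  by (simp_all add: pochhammer_lists_def)

lemma pochhammer_list_Nil [simp]: "pochhammer_list [] n = 1"
  and pochhammer_list_Cons [simp]: "pochhammer_list (a # as) n = pochhammer a n * pochhammer_list as n"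
  and pochhammer_list_append [simp]:
    "pochhammer_list (as @ bs) n = pochhammer_list as n * pochhammer_list bs n"
  by (simp_all add: pochhammer_list_def)

lemma shift_list_Nil [simp]: "shift_list [] [] = []"
  and shift_list_Cons [simp]: "shift_list (f # fs) (m # ms) = (f + of_nat m) # shift_list fs ms"
  by (simp_all add: shift_list_def)

lemma pochhammer_list_neq_0:
  "\<forall>f\<in>set fs. f \<notin> \<int>\<^sub>\<le>\<^sub>0 \<Longrightarrow> pochhammer_list fs n \<noteq> (0 :: complex)"
  by (induction fs) (auto simp: pochhammer_neq_0)

lemma pochhammer_lists_neq_0:
  assumes "length fs = length ms" "\<forall>f\<in>set fs. f \<notin> \<int>\<^sub>\<le>\<^sub>0"
  shows "pochhammer_lists fs ms \<noteq> (0 :: complex)"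
  using assms by (induction rule: list_induct2) (auto simp: pochhammer_neq_0)

lemma degree_shifted_pochhammer_poly:
  "length fs = length ms \<Longrightarrow> degree (shifted_pochhammer_poly fs ms) \<le> sum_list ms"
proof (induction rule: list_induct2)
  case (Cons f fs m ms)
  then show ?case
    using degree_mult_le[of "pochhammer [:f, 1:] m" "shifted_pochhammer_poly fs ms"]
      degree_pochhammer_le[of "[:f, 1:]" m] by simp
qed simp

lemma poly_shifted_pochhammer_poly_0:
  "length fs = length ms \<Longrightarrow> poly (shifted_pochhammer_poly fs ms) 0 = pochhammer_lists fs ms"
  by (induction rule: list_induct2) (simp_all add: poly_pochhammer)

lemma pochhammer_list_shift_list:
  assumes "length fs = length ms"
  shows "pochhammer_list (shift_list fs ms) k * pochhammer_lists fs ms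
    = pochhammer_list fs k * poly (shifted_pochhammer_poly fs ms) (of_nat k)"
  using assms
proof (induction rule: list_induct2)
  case (Cons f fs m ms)
  show ?case
    using arg_cong2[OF Cons.IH pochhammer_add_commute[of f m k], of "(*)"]
    by (simp add: poly_pochhammer mult_ac)
qed simp

lemma pochhammer_list_shift_list_quotient:
  assumes "length fs = length ms" "\<forall>f\<in>set fs. f \<notin> \<int>\<^sub>\<le>\<^sub>0"
  shows "pochhammer_list (shift_list fs ms) k / pochhammer_list fs k
    = poly (shifted_pochhammer_poly fs ms) (of_nat k) / pochhammer_lists fs ms"
  using pochhammer_list_shift_list[OF assms(1), of k] pochhammer_lists_neq_0[OF assms]
    pochhammer_list_neq_0[OF assms(2), of k]
  by (simp add: frac_eq_eq mult_ac)

lemma binomial_transform_mult_right: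
  "binomial_transform (\<lambda>s. C * a s) n = C * binomial_transform a n"
  by (simp add: binomial_transform_def sum_distrib_left mult_ac)

text \<open>Identifies the hypergeometric factors in \<open>Q_poly\<close> as normalised Newton
  coefficients of \<open>(f + t)_m\<close>; after reflection it serves \<open>Y_poly\<close> as
  well.\<close>

lemma hypergeo_shift_list:
  assumes "length fs = length ms" "\<forall>f\<in>set fs. f \<notin> \<int>\<^sub>\<le>\<^sub>0"
  shows "hypergeo (- of_nat k # shift_list fs ms) fs
    = binomial_transform (\<lambda>s. poly (shifted_pochhammer_poly fs ms) (of_nat s)) k
        / pochhammer_lists fs ms"
  unfolding hypergeo_poly_terminating binomial_transform_def sum_divide_distrib
proof (intro sum.cong refl)
  fix j
  show "pochhammer_list (- of_nat k # shift_list fs ms) j / (pochhammer_list fs j * fact j)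
          * poly 1 (of_nat j)
    = pochhammer (- of_nat k) j / fact j * poly (shifted_pochhammer_poly fs ms) (of_nat j)
          / pochhammer_lists fs ms"
    using arg_cong[OF pochhammer_list_shift_list_quotient[OF assms, of j],
        of "\<lambda>y. pochhammer (- of_nat k) j / fact j * y"]
    by (simp add: mult_ac)
qed

section \<open>The polynomial \<open>Q_poly\<close> and its zeros\<close>

text \<open>Computes the transform of the sequence built from \<open>b\<close>, \<open>c\<close> and
  \<open>fs\<close>. At \<open>t = -k\<close> the summands of \<open>Q_poly\<close> match those of
  \<open>binomial_transform_pochhammer_quotient\<close> one by one.\<close>

lemma poly_Q_poly:
  assumes len: "length fs = length ms" and m: "m = sum_list ms"
    and nz: "pochhammer (c - b - of_nat m) m \<noteq> 0"
    and c: "c \<notin> \<int>\<^sub>\<le>\<^sub>0" and fs: "\<forall>f\<in>set fs. f \<notin> \<int>\<^sub>\<le>\<^sub>0"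
  shows "pochhammer (c - b - of_nat m) k / pochhammer c k * poly (Q_poly b c fs ms) (- of_nat k)
    = binomial_transform (\<lambda>j. pochhammer b j / pochhammer c j
         * poly (shifted_pochhammer_poly fs ms) (of_nat j)) k / pochhammer_lists fs ms"
proof -
  let ?y = "c - b - of_nat m"
  let ?q = "binomial_transform (\<lambda>s. poly (shifted_pochhammer_poly fs ms) (of_nat s))"
  let ?A = "pochhammer_lists fs ms"
  have "pochhammer ?y k / pochhammer c k * poly (Q_poly b c fs ms) (- of_nat k)
    = (\<Sum>i\<le>m. pochhammer ?y k / pochhammer c k * (1 / pochhammer ?y m *
        ((-1) ^ i / fact i * (?q i / ?A) * pochhammer b i *
          (pochhammer (- of_nat k) i * pochhammer (?y + of_nat k) (m - i)))))"
    by (simp add: Q_poly_def Let_def m[symmetric] poly_sum poly_pochhammer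
        hypergeo_shift_list[OF len fs] sum_distrib_left)
  also have "\<dots> = (\<Sum>i\<le>m. ?q i * ((-1) ^ i * pochhammer (- of_nat k) i / fact i
           * (pochhammer b i * pochhammer (c - b) (k - i) / pochhammer c k)) / ?A)"
  proof (intro sum.cong refl)
    fix i assume i: "i \<in> {..m}"
    show "pochhammer ?y k / pochhammer c k * (1 / pochhammer ?y m *
        ((-1) ^ i / fact i * (?q i / ?A) * pochhammer b i *
          (pochhammer (- of_nat k) i * pochhammer (?y + of_nat k) (m - i))))
      = ?q i * ((-1) ^ i * pochhammer (- of_nat k) i / fact i
           * (pochhammer b i * pochhammer (c - b) (k - i) / pochhammer c k)) / ?A"
    proof (cases "i \<le> k")
      case True
      \<comment> \<open>Two splittings of \<open>(c-b-m)_(m+k-i)\<close> are compared;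
        \<open>i <= m\<close> and \<open>i <= k\<close> make both subtractions exact.\<close>
      have "pochhammer ?y k * pochhammer (?y + of_nat k) (m - i) = pochhammer ?y (k + (m - i))"
        by (simp add: pochhammer_product')
      also have "k + (m - i) = m + (k - i)"
        using True i by auto
      also have "pochhammer ?y (m + (k - i)) = pochhammer ?y m * pochhammer (c - b) (k - i)"
        by (simp add: pochhammer_product')
      finally have "pochhammer (c - b) (k - i)
          = pochhammer ?y k * pochhammer (?y + of_nat k) (m - i) / pochhammer ?y m"
        using nz by (simp add: field_simps)
      then show ?thesis by (simp add: mult_ac)
    next
      case False
      then have "pochhammer (- of_nat k :: complex) i = 0"
        by (simp add: pochhammer_of_nat_eq_0_iff)
      then show ?thesis by simp
    qed
  qed
  also have "\<dots> = binomial_transform (\<lambda>j. pochhammer b j / pochhammer c j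
         * poly (shifted_pochhammer_poly fs ms) (of_nat j)) k / ?A"
    using binomial_transform_pochhammer_quotient[OF c degree_shifted_pochhammer_poly[OF len], of b k]
    by (simp add: m sum_divide_distrib)
  finally show ?thesis .
qed

lemma pochhammer_list_add_1:
  "pochhammer_list (map (\<lambda>z. z + 1) zs) k * prod_list zs
     = pochhammer_list zs k * (\<Prod>z\<leftarrow>zs. z + of_nat k)"
  for zs :: "'a::comm_semiring_1 list"
proof (induction zs)
  case (Cons z zs)
  show ?case
    using arg_cong2[OF Cons.IH pochhammer_add_commute[of z 1 k], of "(*)"]
    by (simp add: mult_ac)
qed simp

text \<open>Each zero contributes \<open>(z + 1)_k / (z)_k = (z + k) / z\<close>, so the product is
  \<open>Q(-k) / Q(0)\<close> by the factorisation of \<open>Q\<close>; the leading coefficient and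
  the sign cancel.\<close>

lemma pochhammer_list_roots_quotient:
  fixes Q :: "complex poly"
  assumes \<zeta>: "mset \<zeta> = proots Q" "\<forall>z\<in>set \<zeta>. z \<notin> \<int>\<^sub>\<le>\<^sub>0" and Q0: "poly Q 0 = 1"
  shows "pochhammer_list (map (\<lambda>z. z + 1) \<zeta>) k / pochhammer_list \<zeta> k = poly Q (- of_nat k)"
proof -
  have "Q = smult (lead_coeff Q) (\<Prod>x\<leftarrow>\<zeta>. [:-x, 1:])"
    using complex_poly_decompose_multiset[of Q] unfolding \<zeta>(1)[symmetric]
    by (metis mset_map prod_mset_prod_list)
  then have "poly Q x = poly (smult (lead_coeff Q) (\<Prod>z\<leftarrow>\<zeta>. [:-z, 1:])) x" for x
    by simp
  moreover have "poly (\<Prod>z\<leftarrow>\<zeta>. [:-z, 1:]) x = (\<Prod>z\<leftarrow>\<zeta>. x - z)" for x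
    by (induction \<zeta>) (simp_all add: algebra_simps)
  ultimately have Q: "poly Q x = lead_coeff Q * (\<Prod>z\<leftarrow>\<zeta>. x - z)" for x
    by simp
  have neg: "(\<Prod>z\<leftarrow>\<zeta>. - x - z) = (-1) ^ length \<zeta> * (\<Prod>z\<leftarrow>\<zeta>. z + x)" for x
    by (induction \<zeta>) (simp_all add: algebra_simps)
  have Qk: "poly Q (- of_nat k) = lead_coeff Q * (-1) ^ length \<zeta> * (\<Prod>z\<leftarrow>\<zeta>. z + of_nat k)"
    unfolding Q neg by simp
  have one: "lead_coeff Q * (-1) ^ length \<zeta> * prod_list \<zeta> = 1"
    using Q0 Q[of 0] neg[of 0] by (simp add: mult_ac)
  have "pochhammer_list (map (\<lambda>z. z + 1) \<zeta>) k
      = lead_coeff Q * (-1) ^ length \<zeta> * (pochhammer_list (map (\<lambda>z. z + 1) \<zeta>) k * prod_list \<zeta>)"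
    using one by (simp add: mult_ac)
  also have "\<dots> = pochhammer_list \<zeta> k * poly Q (- of_nat k)"
    unfolding pochhammer_list_add_1 Qk by simp
  finally show ?thesis
    using pochhammer_list_neq_0[OF \<zeta>(2), of k] by simp
qed

section \<open>Reflection and the coefficients of \<open>Y_poly\<close>\<close>

lemma shifted_pochhammer_poly_reflect:
  assumes "length hs = length ps"
  shows "poly (shifted_pochhammer_poly (map2 (\<lambda>h q. 1 - h + d - of_nat q) hs ps) ps) x
    = (-1) ^ sum_list ps * poly (shifted_pochhammer_poly hs ps) (- d - x)"
  using assms
proof (induction rule: list_induct2)
  case (Cons h hs q ps)
  have "pochhammer (1 - h + d - of_nat q + x) q = (-1) ^ q * pochhammer (h + (- d - x)) q"
    by (rule pochhammer_diff_swap) simp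
  then show ?case
    using Cons by (simp add: poly_pochhammer power_add)
qed simp

lemma shift_list_reflect:
  assumes "length hs = length ps"
  shows "shift_list (map2 (\<lambda>h q. 1 - h + d - of_nat q) hs ps) ps = map (\<lambda>h. 1 - h + d) hs"
  using assms by (induction rule: list_induct2) simp_all

lemma pochhammer_lists_diff:
  assumes "length hs = length ps"
  shows "pochhammer_lists (map (\<lambda>h. h - d) hs) ps = poly (shifted_pochhammer_poly hs ps) (- d)"
  using assms by (induction rule: list_induct2) (simp_all add: poly_pochhammer)

text \<open>The upper parameters \<open>1 - h + d\<close> exceed the lower ones by
  \<open>ps\<close>, so \<open>hypergeo_shift_list\<close> applies. Reflecting numerator and
  denominator gives the same sign, and the prefactor \<open>(h - d)_p\<close> of
  \<open>Y_poly\<close> removes the normalisation. The results are the coordinates of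
  \<open>(h + t)_p\<close> in the basis \<open>(d + t)_j / j!\<close>.\<close>

lemma hypergeo_reflect:
  assumes len: "length hs = length ps"
    and h: "\<forall>i<length hs. 1 - hs ! i + d - of_nat (ps ! i) \<notin> \<int>\<^sub>\<le>\<^sub>0"
  shows "pochhammer_lists (map (\<lambda>h. h - d) hs) ps
      * hypergeo (- of_nat j # map (\<lambda>h. 1 - h + d) hs) (map2 (\<lambda>h q. 1 - h + d - of_nat q) hs ps)
    = binomial_transform (\<lambda>s. poly (shifted_pochhammer_poly hs ps) (- d - of_nat s)) j"
proof -
  let ?gs = "map2 (\<lambda>h q. 1 - h + d - of_nat q) hs ps"
  have len': "length ?gs = length ps" using len by simp
  have gs: "\<forall>g\<in>set ?gs. g \<notin> \<int>\<^sub>\<le>\<^sub>0"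
    using h len by (auto simp: set_zip)
  have "pochhammer_lists ?gs ps = (-1) ^ sum_list ps * pochhammer_lists (map (\<lambda>h. h - d) hs) ps"
    using shifted_pochhammer_poly_reflect[OF len, of d 0]
    by (simp add: poly_shifted_pochhammer_poly_0[OF len'] pochhammer_lists_diff[OF len])
  moreover have "pochhammer_lists ?gs ps \<noteq> 0"
    by (rule pochhammer_lists_neq_0[OF len' gs])
  ultimately show ?thesis
    unfolding shift_list_reflect[OF len, symmetric] hypergeo_shift_list[OF len' gs]
      shifted_pochhammer_poly_reflect[OF len] binomial_transform_mult_right
    by simp
qed

text \<open>Used with \<open>x = e - d\<close> to turn the Chu-Vandermonde values into the summands
  of \<open>Y_poly\<close>. Split \<open>(1-x-n)_(p+k)\<close> after \<open>k + i\<close> factors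
  and reverse the first piece: it continues \<open>(x-i)_(n-k)\<close> to
  \<open>(x-i)_(n+i)\<close>, which splits again at \<open>x\<close>.\<close>

lemma pochhammer_reflect_identity:
  fixes x :: complex
  assumes "i \<le> p" "k \<le> n"
  shows "pochhammer (x - of_nat i) (n - k) * pochhammer (1 - x - of_nat n) (p + k)
    = (-1) ^ k * (pochhammer x n * pochhammer (1 - x) i
        * pochhammer (of_nat k - x - of_nat n + of_nat i + 1) (p - i))"
proof -
  have "pochhammer (1 - x - of_nat n) (p + k) = pochhammer (1 - x - of_nat n) ((k + i) + (p - i))"
    using assms by (simp add: add.commute)
  also have "\<dots> = pochhammer (1 - x - of_nat n) (k + i)
      * pochhammer (of_nat k - x - of_nat n + of_nat i + 1) (p - i)"
    by (simp add: pochhammer_product' algebra_simps)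
  also have "pochhammer (1 - x - of_nat n) (k + i)
      = (-1) ^ (k + i) * pochhammer (x - of_nat i + of_nat (n - k)) (k + i)"
    by (rule pochhammer_diff_swap) (use assms in \<open>simp add: of_nat_diff\<close>)
  finally have 1: "pochhammer (1 - x - of_nat n) (p + k)
      = (-1) ^ (k + i) * pochhammer (x - of_nat i + of_nat (n - k)) (k + i)
        * pochhammer (of_nat k - x - of_nat n + of_nat i + 1) (p - i)" .
  have "pochhammer (x - of_nat i) (n - k) * pochhammer (x - of_nat i + of_nat (n - k)) (k + i)
      = pochhammer (x - of_nat i) (i + n)"
    using assms pochhammer_product'[of "x - of_nat i" "n - k" "k + i"] by (simp add: add.commute)
  also have "\<dots> = pochhammer (x - of_nat i) i * pochhammer x n"
    by (simp add: pochhammer_product')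
  also have "pochhammer (x - of_nat i) i = (-1) ^ i * pochhammer (1 - x) i"
    by (rule pochhammer_diff_swap) simp
  finally have 2: "pochhammer (x - of_nat i) (n - k) * pochhammer (x - of_nat i + of_nat (n - k)) (k + i)
      = (-1) ^ i * pochhammer (1 - x) i * pochhammer x n" .
  have "pochhammer (x - of_nat i) (n - k) * pochhammer (1 - x - of_nat n) (p + k)
      = (-1) ^ (k + i) * (pochhammer (x - of_nat i) (n - k)
          * pochhammer (x - of_nat i + of_nat (n - k)) (k + i))
        * pochhammer (of_nat k - x - of_nat n + of_nat i + 1) (p - i)"
    unfolding 1 by simp
  also have "\<dots> = (-1) ^ k * (pochhammer x n * pochhammer (1 - x) i
      * pochhammer (of_nat k - x - of_nat n + of_nat i + 1) (p - i))"
    unfolding 2 by (simp add: power_add flip: power_mult_distrib)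
  finally show ?thesis .
qed

text \<open>The case \<open>m = 0\<close> with omitted parameters is included: for
  \<open>fs = []\<close> the polynomial \<open>Q_poly\<close> is 1 and \<open>\<zeta>\<close> is
  empty.\<close>

theorem theorem4:
  fixes r l m p n :: nat
    and ms ps :: "nat list"
    and fs hs \<zeta> :: "complex list"
    and b c d e :: complex
  assumes "length ms = r" "length fs = r" "m = sum_list ms"
    and "length ps = l" "length hs = l" "p = sum_list ps"
    and "\<forall>f\<in>set fs. b \<noteq> f"
    and "pochhammer (c - b - of_nat m) m \<noteq> 0"
    and "degree (Q_poly b c fs ms) = m"
    and "mset \<zeta> = proots (Q_poly b c fs ms)"
    and "c \<notin> \<int>\<^sub>\<le>\<^sub>0" "e \<notin> \<int>\<^sub>\<le>\<^sub>0"
    and "\<forall>f\<in>set fs. f \<notin> \<int>\<^sub>\<le>\<^sub>0" "\<forall>h\<in>set hs. h \<notin> \<int>\<^sub>\<le>\<^sub>0"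
    and "\<forall>z\<in>set \<zeta>. z \<notin> \<int>\<^sub>\<le>\<^sub>0"
    and "1 + d - e - of_nat n + of_nat p \<notin> \<int>\<^sub>\<le>\<^sub>0"
    and "\<forall>i<l. 1 - hs ! i + d - of_nat (ps ! i) \<notin> \<int>\<^sub>\<le>\<^sub>0"
    and "e - d \<notin> \<int>\<^sub>\<le>\<^sub>0"
    and "pochhammer (1 + d - e - of_nat n) p \<noteq> 0"
  shows "hypergeo (- of_nat n # b # d # shift_list fs ms @ shift_list hs ps) (c # e # fs @ hs) =
         pochhammer (e - d) n * Gamma (e - d)
           / (pochhammer e n * pochhammer (1 + d - e - of_nat n) p * pochhammer_lists hs ps)
         * hypergeo_poly
             (- of_nat n # (c - b - of_nat m) # d # map (\<lambda>z. z + 1) \<zeta>)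
             (c # (1 + d - e - of_nat n + of_nat p) # \<zeta>)
             (Y_poly d e hs ps (of_nat n) 1 1)"
proof -
  note nz = assms(8) and c = assms(11) and e = assms(12) and fs = assms(13) and hs = assms(14)
    and z = assms(15)
  have lf: "length fs = length ms" and lh: "length hs = length ps" using assms by auto
  let ?P = "shifted_pochhammer_poly fs ms" and ?H = "shifted_pochhammer_poly hs ps"
  let ?A = "pochhammer_lists fs ms" and ?B = "pochhammer_lists hs ps"
  let ?Q = "Q_poly b c fs ms"
  let ?a = "\<lambda>j. pochhammer b j / pochhammer c j * poly ?P (of_nat j) / ?A"
  let ?E = "binomial_transform (\<lambda>s. poly ?H (- d - of_nat s))"
  let ?x = "1 + d - e - of_nat n"
  have A: "?A \<noteq> 0"
    by (rule pochhammer_lists_neq_0[OF lf fs])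

  have trans_a: "binomial_transform ?a k
      = pochhammer (c - b - of_nat m) k / pochhammer c k * poly ?Q (- of_nat k)" for k
    using binomial_transform_mult_right[of "1 / ?A"
        "\<lambda>j. pochhammer b j / pochhammer c j * poly ?P (of_nat j)" k]
    unfolding poly_Q_poly[OF lf assms(3) nz c fs] by (simp add: mult_ac)
  \<comment> \<open>At \<open>k = 0\<close> the transform reduces to its first term
    \<open>(f)_m / (f)_m\<close>.\<close>
  have Q0: "poly ?Q 0 = 1"
    using trans_a[of 0] A
    by (simp add: binomial_transform_def poly_shifted_pochhammer_poly_0[OF lf])
  have roots: "pochhammer_list (map (\<lambda>z. z + 1) \<zeta>) k / pochhammer_list \<zeta> k
      = poly ?Q (- of_nat k)" for k
    by (rule pochhammer_list_roots_quotient[OF assms(10) z Q0])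

  have H: "poly ?H t = (\<Sum>i\<le>p. ?E i * (pochhammer (d + t) i / fact i))" for t
  proof -
    have "degree (?H \<circ>\<^sub>p [:- d, -1:]) \<le> p"
      using degree_pcompose_le[of ?H "[:- d, -1:]"] degree_shifted_pochhammer_poly[OF lh]
      by (simp add: assms(6))
    \<comment> \<open>Expanding \<open>s -> H(-d - s)\<close> at \<open>s = -(d + t)\<close>
      recovers \<open>H(t)\<close> and turns the Newton basis \<open>(-s)_i\<close> into
      \<open>(d + t)_i\<close>.\<close>
    from newton_expansion[OF this, of "- (d + t)"] show ?thesis
      by (simp add: poly_pcompose add.commute)
  qed

  have "hypergeo (- of_nat n # b # d # shift_list fs ms @ shift_list hs ps) (c # e # fs @ hs)
    = (\<Sum>j\<le>n. pochhammer (- of_nat n) j / fact j * (pochhammer d j / pochhammer e j)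
        * (pochhammer b j / pochhammer c j)
        * (pochhammer_list (shift_list fs ms) j / pochhammer_list fs j)
        * (pochhammer_list (shift_list hs ps) j / pochhammer_list hs j))"
    unfolding hypergeo_poly_terminating by (intro sum.cong refl) (simp add: mult_ac)
  also have "\<dots> = 1 / ?B * (\<Sum>j\<le>n. pochhammer (- of_nat n) j / fact j
        * (pochhammer d j / pochhammer e j) * poly ?H (of_nat j) * ?a j)"
    unfolding pochhammer_list_shift_list_quotient[OF lf fs]
      pochhammer_list_shift_list_quotient[OF lh hs] sum_distrib_left
    by (intro sum.cong refl) (simp add: mult_ac)
  also have "\<dots> = 1 / ?B * (\<Sum>k\<le>n. (-1) ^ k * pochhammer (- of_nat n) k / fact k
        * binomial_transform ?a k
        * (\<Sum>i\<le>p. ?E i / fact i * (pochhammer d (k + i) * pochhammer (e - d - of_nat i) (n - k)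
                       / pochhammer e n)))"
    unfolding sum_binomial_transform_kernel[OF e H] ..
  also have "\<dots> = pochhammer (e - d) n * Gamma (e - d)
           / (pochhammer e n * pochhammer ?x p * ?B)
         * hypergeo_poly
             (- of_nat n # (c - b - of_nat m) # d # map (\<lambda>z. z + 1) \<zeta>)
             (c # (?x + of_nat p) # \<zeta>) (Y_poly d e hs ps (of_nat n) 1 1)"
    unfolding hypergeo_poly_terminating sum_distrib_left[of _ _ "{..n}"]
  proof (intro sum.cong refl)
    fix k assume k: "k \<in> {..n}"
    let ?w = "\<lambda>i. pochhammer (d - e - of_nat n + of_nat i + 1 + of_nat k) (p - i)"
    \<comment> \<open>\<open>?X\<close> joins the prefactor \<open>(1+d-e-n)_p\<close> with the
      lower-parameter symbol \<open>(1+d-e-n+p)_k\<close>.\<close>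
    let ?X = "pochhammer ?x (p + k)"
    have X: "?X = pochhammer ?x p * pochhammer (?x + of_nat p) k"
      by (rule pochhammer_product')
    have X0: "?X \<noteq> 0"
      unfolding X using assms(16,19) by (simp add: pochhammer_neq_0)
    have reflect: "?E i = pochhammer_lists (map (\<lambda>h. h - d) hs) ps
        * hypergeo (- of_nat i # map (\<lambda>h. 1 - h + d) hs)
            (map2 (\<lambda>h q. 1 - h + d - of_nat q) hs ps)" for i
      by (rule hypergeo_reflect[symmetric]) (use lh assms in auto)
    have Y: "poly (Y_poly d e hs ps (of_nat n) 1 1) (of_nat k)
        = 1 / Gamma (e - d) * (\<Sum>i\<le>p. ?E i / fact i
            * (pochhammer (d - e + 1) i * pochhammer (d + of_nat k) i * ?w i))"
      unfolding Y_poly_def Let_def assms(6)[symmetric] reflect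
      by (simp add: poly_sum poly_pochhammer sum_distrib_left mult_ac)
    have "(\<Sum>i\<le>p. ?E i / fact i * (pochhammer d (k + i) * pochhammer (e - d - of_nat i) (n - k)
                       / pochhammer e n))
        = (\<Sum>i\<le>p. (-1) ^ k * pochhammer d k * pochhammer (e - d) n / (pochhammer e n * ?X)
            * (?E i / fact i * (pochhammer (d - e + 1) i * pochhammer (d + of_nat k) i * ?w i)))"
    proof (intro sum.cong refl)
      fix i assume i: "i \<in> {..p}"
      have "pochhammer (e - d - of_nat i) (n - k) * ?X
          = (-1) ^ k * (pochhammer (e - d) n * pochhammer (d - e + 1) i * ?w i)"
        using pochhammer_reflect_identity[of i p k n "e - d"] i k
        by (simp add: algebra_simps)
      then have "pochhammer (e - d - of_nat i) (n - k)
          = (-1) ^ k * (pochhammer (e - d) n * pochhammer (d - e + 1) i * ?w i) / ?X"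
        using X0 by (metis nonzero_eq_divide_eq)
      with pochhammer_product'[of d k i]
      show "?E i / fact i * (pochhammer d (k + i) * pochhammer (e - d - of_nat i) (n - k)
                       / pochhammer e n)
        = (-1) ^ k * pochhammer d k * pochhammer (e - d) n / (pochhammer e n * ?X)
            * (?E i / fact i * (pochhammer (d - e + 1) i * pochhammer (d + of_nat k) i * ?w i))"
        by (simp only: mult_ac times_divide_eq_left times_divide_eq_right divide_divide_eq_left)
    qed
    also have "\<dots> = (-1) ^ k * pochhammer d k * pochhammer (e - d) n / (pochhammer e n * ?X)
        * (Gamma (e - d) * poly (Y_poly d e hs ps (of_nat n) 1 1) (of_nat k))"
      unfolding Y sum_distrib_left[symmetric] using assms(18) by (simp add: Gamma_eq_zero_iff)
    finally have inner: "(\<Sum>i\<le>p. ?E i / fact i * (pochhammer d (k + i)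
          * pochhammer (e - d - of_nat i) (n - k) / pochhammer e n))
      = (-1) ^ k * pochhammer d k * pochhammer (e - d) n / (pochhammer e n * ?X)
        * (Gamma (e - d) * poly (Y_poly d e hs ps (of_nat n) 1 1) (of_nat k))" .
    \<comment> \<open>One sign comes from the expansion in the transform, the other from
      \<open>pochhammer_reflect_identity\<close>.\<close>
    have sign: "(-1) ^ k * ((-1) ^ k * y) = y" for y :: complex
      by (simp flip: mult.assoc power_mult_distrib)
    show "1 / ?B * ((-1) ^ k * pochhammer (- of_nat n) k / fact k
        * binomial_transform ?a k
        * (\<Sum>i\<le>p. ?E i / fact i * (pochhammer d (k + i) * pochhammer (e - d - of_nat i) (n - k)
                       / pochhammer e n)))
      = pochhammer (e - d) n * Gamma (e - d) / (pochhammer e n * pochhammer ?x p * ?B)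
        * (pochhammer_list (- of_nat n # (c - b - of_nat m) # d # map (\<lambda>z. z + 1) \<zeta>) k
           / (pochhammer_list (c # (?x + of_nat p) # \<zeta>) k * fact k)
           * poly (Y_poly d e hs ps (of_nat n) 1 1) (of_nat k))"
      unfolding inner trans_a roots[symmetric] X by (simp add: mult_ac sign)
  qed
  finally show ?thesis .
qed

end
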